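(* In the payment network creation game with $n\ge 4$ players, betweenness weight $b\ge 0$ and closeness weight $c>0$, the star graph is a Nash equilibrium if and only if $0\le 1-\frac{n-3}{2}\,b-c$.
   Context: Payment network creation game. There are $n$ players $[n]=\{0,1,\dots,n-1\}$. A strategy of player $u$ is a set $s_u\subseteq [n]\setminus\{u\}$ (the players to whom $u$ opens a channel). A strategy combination is $s=(s_0,\dots,s_{n-1})$, and $G[s]$ is the undirected simple graph on $[n]$ in which $u,v$ are adjacent iff $v\in s_u$ or $u\in s_v$. With weights $b\ge 0$ and $c>0$, the cost of $u$ is $$\mathrm{cost}_u(s)=|s_u|+b\cdot \mathrm{betweenness}_u(s)+c\cdot \mathrm{closeness}_u(s),$$ $$\mathrm{betweenness}_u(s)=(n-1)(n-2)-\sum_{\substack{(i,j)\in[n]^2:\ i\ne j,\ i\neq u,\ j\ne u,\\ m(i,j)>0}}\frac{m_u(i,j)}{m(i,j)},\qquad \mathrm{closeness}_u(s)=\sum_{v\in[n]\setminus\{u\}}\bigl(d_{G[s]}(u,v)-1\bigr).$$ The sum in the betweenness runs over ordered pairs; $m(i,j)$ is the number of shortest paths between $i$ and $j$ in $G[s]$ and $m_u(i,j)$ the number of those passing through $u$; $d_{G[s]}$ is graph distance, equal to $\infty$ between different components. A strategy combination $s$ is a Nash equilibrium if no player can strictly decrease her cost by unilaterally changing her strategy; a graph $G$ is called a Nash equilibrium if $G=G[s]$ for some strategy combination $s$ that is a Nash equilibrium. The star graph is $K_{1,n-1}$ on all players. *)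

theory Defs
  imports Complex_Main "HOL-Library.Extended_Real"
begin

text \<open>
  The players are the natural numbers below \<open>n\<close>. A simple graph on the players is given by its
  set of edges, each edge being a two-element set of players.
\<close>

definition strategies :: "nat \<Rightarrow> nat \<Rightarrow> nat set set" where
  "strategies n u = Pow ({..<n} - {u})"

text \<open>Only the values of \<open>s\<close> at players matter, here and below.\<close>

definition strategy_combination :: "nat \<Rightarrow> (nat \<Rightarrow> nat set) \<Rightarrow> bool" where
  "strategy_combination n s \<longleftrightarrow> (\<forall>u<n. s u \<in> strategies n u)"

definition created_graph :: "nat \<Rightarrow> (nat \<Rightarrow> nat set) \<Rightarrow> nat set set" where
  "created_graph n s = {{u, v} |u v. u < n \<and> v < n \<and> (v \<in> s u \<or> u \<in> s v)}"

text \<open>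
  A path is the list of the vertices it visits, in order; its length is the number of edges, that
  is, the length of the list minus one.
\<close>

definition graph_paths :: "nat set set \<Rightarrow> nat \<Rightarrow> nat \<Rightarrow> nat list set" where
  "graph_paths E i j =
     {p. p \<noteq> [] \<and> hd p = i \<and> last p = j \<and> distinct p \<and> successively (\<lambda>x y. {x, y} \<in> E) p}"

definition path_length :: "nat list \<Rightarrow> nat" where
  "path_length p = length p - 1"

text \<open>The infimum of the empty set in \<^typ>\<open>enat\<close> is \<open>\<infinity>\<close>.\<close>

definition graph_dist :: "nat set set \<Rightarrow> nat \<Rightarrow> nat \<Rightarrow> enat" where
  "graph_dist E i j = (INF p\<in>graph_paths E i j. enat (path_length p))"

definition shortest_paths :: "nat set set \<Rightarrow> nat \<Rightarrow> nat \<Rightarrow> nat list set" where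
  "shortest_paths E i j = {p \<in> graph_paths E i j. enat (path_length p) = graph_dist E i j}"

definition num_shortest :: "nat set set \<Rightarrow> nat \<Rightarrow> nat \<Rightarrow> nat" where
  "num_shortest E i j = card (shortest_paths E i j)"

definition num_shortest_through :: "nat set set \<Rightarrow> nat \<Rightarrow> nat \<Rightarrow> nat \<Rightarrow> nat" where
  "num_shortest_through E u i j = card {p \<in> shortest_paths E i j. u \<in> set p}"

definition betweenness :: "nat \<Rightarrow> nat set set \<Rightarrow> nat \<Rightarrow> real" where
  "betweenness n E u =
     (real n - 1) * (real n - 2) -
     (\<Sum>(i, j) \<in> {(i, j). i < n \<and> j < n \<and> i \<noteq> j \<and> i \<noteq> u \<and> j \<noteq> u \<and> num_shortest E i j > 0}.
        real (num_shortest_through E u i j) / real (num_shortest E i j))"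

definition closeness :: "nat \<Rightarrow> nat set set \<Rightarrow> nat \<Rightarrow> ereal" where
  "closeness n E u = (\<Sum>v\<in>{..<n} - {u}. ereal_of_enat (graph_dist E u v) - 1)"

definition cost :: "nat \<Rightarrow> real \<Rightarrow> real \<Rightarrow> (nat \<Rightarrow> nat set) \<Rightarrow> nat \<Rightarrow> ereal" where
  "cost n b c s u =
     ereal (real (card (s u))) + ereal b * ereal (betweenness n (created_graph n s) u)
     + ereal c * closeness n (created_graph n s) u"

definition nash_equilibrium :: "nat \<Rightarrow> real \<Rightarrow> real \<Rightarrow> (nat \<Rightarrow> nat set) \<Rightarrow> bool" where
  "nash_equilibrium n b c s \<longleftrightarrow>
     strategy_combination n s \<and>
     (\<forall>u<n. \<not> (\<exists>t\<in>strategies n u. cost n b c (s(u := t)) u < cost n b c s u))"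

definition nash_equilibrium_graph :: "nat \<Rightarrow> real \<Rightarrow> real \<Rightarrow> nat set set \<Rightarrow> bool" where
  "nash_equilibrium_graph n b c G \<longleftrightarrow> (\<exists>s. nash_equilibrium n b c s \<and> G = created_graph n s)"

text \<open>The star on all players with centre \<open>r\<close>.\<close>

definition star_graph :: "nat \<Rightarrow> nat \<Rightarrow> nat set set" where
  "star_graph n r = {{r, v} |v. v < n \<and> v \<noteq> r}"

end

theory Submission
  imports Defs
begin

text \<open>
  Every leaf \<open>u\<close> of the star can only usefully add channels to a set \<open>K\<close> of other leaves. This
  changes its cost by \<open>k - c k - b k (k - 1) / 2\<close> where \<open>k = card K\<close>: each ordered pair of leaves
  in \<open>K\<close> is then joined by two shortest paths, one through the centre and one through \<open>u\<close>.
  The change is \<open>k\<close> times an affine non-increasing function of \<open>k\<close>, so the extreme case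
  \<open>k = n - 2\<close> decides. If the centre pays for all channels, it cannot drop one without
  disconnecting a leaf.
\<close>

section \<open>Shortest paths of length at most two\<close>

lemma graph_dist_le:
  assumes "p \<in> graph_paths E i j"
  shows "graph_dist E i j \<le> enat (path_length p)"
  unfolding graph_dist_def using assms by (rule INF_lower)

lemma path_length_ge_1:
  assumes "p \<in> graph_paths E i j" "i \<noteq> j"
  shows "1 \<le> path_length p"
  using assms by (cases p) (auto simp: graph_paths_def path_length_def Suc_le_eq)

lemma path_length_1_cases:
  assumes "p \<in> graph_paths E i j" "path_length p = 1"
  shows "p = [i, j] \<and> {i, j} \<in> E"
proof -
  from assms(2) have "length p = Suc (Suc 0)"
    by (auto simp: path_length_def)
  then obtain x y where "p = [x, y]"
    by (auto simp: length_Suc_conv)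
  with assms(1) show ?thesis
    by (auto simp: graph_paths_def)
qed

lemma path_length_2_cases:
  assumes "p \<in> graph_paths E i j" "path_length p = 2"
  obtains w where "p = [i, w, j]" "{i, w} \<in> E" "{w, j} \<in> E" "w \<noteq> i" "w \<noteq> j"
proof -
  from assms(2) have "length p = Suc (Suc (Suc 0))"
    by (auto simp: path_length_def)
  then obtain x y z where "p = [x, y, z]"
    by (auto simp: length_Suc_conv)
  with assms(1) show ?thesis
    by (intro that[of y]) (auto simp: graph_paths_def)
qed

lemma graph_dist_adjacent:
  assumes "{i, j} \<in> E" "i \<noteq> j"
  shows "graph_dist E i j = 1"
proof (rule antisym)
  have "[i, j] \<in> graph_paths E i j"
    using assms by (auto simp: graph_paths_def)
  from graph_dist_le[OF this] show "graph_dist E i j \<le> 1"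
    by (simp add: path_length_def one_enat_def)
  show "1 \<le> graph_dist E i j"
    unfolding graph_dist_def one_enat_def
    by (rule INF_greatest) (use path_length_ge_1[OF _ assms(2)] in auto)
qed

lemma shortest_paths_adjacent:
  assumes "{i, j} \<in> E" "i \<noteq> j"
  shows "shortest_paths E i j = {[i, j]}"
proof -
  have "[i, j] \<in> graph_paths E i j"
    using assms by (auto simp: graph_paths_def)
  then show ?thesis
    unfolding shortest_paths_def graph_dist_adjacent[OF assms]
    by (auto simp: one_enat_def dest: path_length_1_cases) (simp add: path_length_def)
qed

lemma graph_dist_common_neighbour:
  assumes "{i, j} \<notin> E" "i \<noteq> j" "{i, w} \<in> E" "{w, j} \<in> E" "w \<noteq> i" "w \<noteq> j"
  shows "graph_dist E i j = 2"
proof (rule antisym)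
  have "[i, w, j] \<in> graph_paths E i j"
    using assms by (auto simp: graph_paths_def)
  from graph_dist_le[OF this] show "graph_dist E i j \<le> 2"
    by (simp add: path_length_def numeral_eq_enat eval_nat_numeral)
  have "2 \<le> path_length p" if "p \<in> graph_paths E i j" for p
    using path_length_ge_1[OF that assms(2)] path_length_1_cases[OF that] assms(1)
    by fastforce
  then show "2 \<le> graph_dist E i j"
    unfolding graph_dist_def by (auto simp: numeral_eq_enat intro!: INF_greatest)
qed

text \<open>A path with two edges is determined by its midpoint, so counting shortest paths between
  non-adjacent players becomes counting common neighbours. The given \<open>w\<close> only certifies
  that the distance is two.\<close>

lemma shortest_paths_common_neighbour:
  assumes "{i, j} \<notin> E" "i \<noteq> j" "{i, w} \<in> E" "{w, j} \<in> E" "w \<noteq> i" "w \<noteq> j"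
  shows "shortest_paths E i j =
    (\<lambda>x. [i, x, j]) ` {x. {i, x} \<in> E \<and> {x, j} \<in> E \<and> x \<noteq> i \<and> x \<noteq> j}" (is "_ = ?R")
proof
  show "shortest_paths E i j \<subseteq> ?R"
  proof
    fix p assume "p \<in> shortest_paths E i j"
    then have "p \<in> graph_paths E i j" "path_length p = 2"
      by (auto simp: shortest_paths_def graph_dist_common_neighbour[OF assms] numeral_eq_enat)
    then show "p \<in> ?R"
      by (rule path_length_2_cases) blast
  qed
  show "?R \<subseteq> shortest_paths E i j"
    using assms(2)
    by (auto simp: shortest_paths_def graph_dist_common_neighbour[OF assms] graph_paths_def
        path_length_def numeral_eq_enat)
qed

text \<open>The penultimate vertex of a path ending in \<open>v\<close> would be a neighbour of
  \<open>v\<close>, so the infimum ranges over the empty set. This makes it infinitely costly for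
  the centre to drop a channel.\<close>

lemma graph_dist_isolated:
  assumes "\<And>x. {x, v} \<notin> E" "i \<noteq> v"
  shows "graph_dist E i v = \<infinity>"
proof -
  have "p \<notin> graph_paths E i v" for p
  proof
    assume p: "p \<in> graph_paths E i v"
    then obtain q where q: "p = q @ [v]"
      by (auto simp: graph_paths_def) (metis append_butlast_last_id)
    with p assms(2) have "q \<noteq> []"
      by (auto simp: graph_paths_def)
    with p q have "{last q, v} \<in> E"
      by (auto simp: graph_paths_def successively_append_iff)
    with assms(1) show False by blast
  qed
  then have "graph_paths E i v = {}" by blast
  then show ?thesis
    by (simp add: graph_dist_def top_enat_def)
qed

section \<open>The star with additional channels at one leaf\<close>

definition augmented_star :: "nat \<Rightarrow> nat \<Rightarrow> nat \<Rightarrow> nat set \<Rightarrow> nat set set" where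
  "augmented_star n r u K = star_graph n r \<union> {{u, v} |v. v \<in> K}"

lemma augmented_star_empty [simp]: "augmented_star n r u {} = star_graph n r"
  by (simp add: augmented_star_def)

text \<open>The case \<open>K = {}\<close> is the star itself, so one set of formulas gives the cost
  of a leaf \<open>u\<close> both before and after its deviation. Since \<open>r\<close> is excluded
  from \<open>K\<close>, each member of \<open>K\<close> yields a genuinely new edge.\<close>

locale leaf_deviation =
  fixes n r u :: nat and K :: "nat set"
  assumes r: "r < n" and u: "u < n" "u \<noteq> r" and K: "K \<subseteq> {..<n} - {r, u}"
begin

abbreviation "E \<equiv> augmented_star n r u K"

lemma finite_K: "finite K"
  using K by (rule finite_subset) simp

lemma card_K_le: "card K \<le> n - 2"
proof -
  have "card ({..<n} - {r, u}) = n - 2"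
    using r u by (subst card_Diff_subset) auto
  then show ?thesis
    using card_mono[OF _ K] by simp
qed

lemma adjacent_iff:
  assumes "i < n" "j < n" "i \<noteq> j"
  shows "{i, j} \<in> E \<longleftrightarrow> i = r \<or> j = r \<or> (i = u \<and> j \<in> K) \<or> (j = u \<and> i \<in> K)"
  using assms K u unfolding augmented_star_def star_graph_def
  by (auto simp: doubleton_eq_iff)

lemma adjacent_less:
  assumes "{i, j} \<in> E"
  shows "i < n" "j < n"
  using assms K u r unfolding augmented_star_def star_graph_def
  by (auto simp: doubleton_eq_iff)

lemma graph_dist_from_u:
  assumes "v < n" "v \<noteq> u"
  shows "graph_dist E u v = (if v = r \<or> v \<in> K then 1 else 2)"
proof (cases "v = r \<or> v \<in> K")
  case True
  then show ?thesis
    using assms u by (auto simp: adjacent_iff intro!: graph_dist_adjacent)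
next
  case False
  then have "graph_dist E u v = 2"
    using assms u r K by (intro graph_dist_common_neighbour[of _ _ _ r]) (auto simp: adjacent_iff)
  with False show ?thesis by simp
qed

text \<open>The centre and the leaves in \<open>K\<close> are adjacent to \<open>u\<close> and
  contribute 0; every other leaf is reached through \<open>r\<close> at distance two and contributes
  1.\<close>

lemma closeness_u: "closeness n E u = ereal (real n - 2 - real (card K))"
proof -
  have "closeness n E u = (\<Sum>v\<in>{..<n} - {u}. ereal (if v = r \<or> v \<in> K then 0 else 1))"
    unfolding closeness_def
    by (rule sum.cong) (auto simp: graph_dist_from_u numeral_eq_enat one_enat_def one_ereal_def)
  also have "\<dots> = ereal (\<Sum>v\<in>{..<n} - {u}. if v = r \<or> v \<in> K then 0 else 1)"
    by simp
  also have "(\<Sum>v\<in>{..<n} - {u}. if v = r \<or> v \<in> K then 0 else (1::real)) =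
      (\<Sum>v\<in>{..<n} - {r, u} - K. 1)"
    by (rule sum.mono_neutral_cong_right) auto
  also have "\<dots> = real n - 2 - real (card K)"
  proof -
    have "card ({..<n} - {r, u}) = n - 2"
      using r u by (subst card_Diff_subset) auto
    then have "card ({..<n} - {r, u} - K) = n - 2 - card K"
      using K by (subst card_Diff_subset) (auto simp: finite_K)
    then show ?thesis
      \<comment> \<open>As \<open>r\<close> and \<open>u\<close> are distinct players,
        \<open>n\<close> is at least 2; with \<open>card_K_le\<close>, neither natural subtraction
        is truncated.\<close>
      using card_K_le r u by (simp add: of_nat_diff)
  qed
  finally show ?thesis .
qed

text \<open>Two leaves other than \<open>u\<close> always share the neighbour \<open>r\<close>. All
  added edges meet \<open>u\<close>, so the only other possible common neighbour is
  \<open>u\<close>, and it is one exactly when both leaves lie in \<open>K\<close>.\<close>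

lemma shortest_paths_avoiding_u:
  assumes "i < n" "j < n" "i \<noteq> j" "i \<noteq> u" "j \<noteq> u"
  shows "shortest_paths E i j =
    (if i = r \<or> j = r then {[i, j]}
     else if i \<in> K \<and> j \<in> K then {[i, r, j], [i, u, j]} else {[i, r, j]})"
proof (cases "i = r \<or> j = r")
  case True
  then show ?thesis
    using assms by (simp add: shortest_paths_adjacent adjacent_iff)
next
  case False
  have "{i, j} \<notin> E" "{i, r} \<in> E" "{r, j} \<in> E"
    using False assms r by (auto simp: adjacent_iff)
  with False have "shortest_paths E i j =
      (\<lambda>x. [i, x, j]) ` {x. {i, x} \<in> E \<and> {x, j} \<in> E \<and> x \<noteq> i \<and> x \<noteq> j}"
    using assms by (intro shortest_paths_common_neighbour[of _ _ _ r]) auto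
  \<comment> \<open>The bound \<open>x < n\<close> is made explicit because
    \<open>adjacent_iff\<close> speaks only of players.\<close>
  also have "{x. {i, x} \<in> E \<and> {x, j} \<in> E \<and> x \<noteq> i \<and> x \<noteq> j} =
      {x. x < n \<and> {i, x} \<in> E \<and> {x, j} \<in> E \<and> x \<noteq> i \<and> x \<noteq> j}"
    by (auto dest: adjacent_less)
  also have "\<dots> = (if i \<in> K \<and> j \<in> K then {r, u} else {r})"
    using False assms u r by (auto simp: adjacent_iff)
  finally show ?thesis
    using False by auto
qed

lemma betweenness_u:
  "betweenness n E u = (real n - 1) * (real n - 2) - real (card K) * (real (card K) - 1) / 2"
proof -
  let ?A = "{(i, j). i < n \<and> j < n \<and> i \<noteq> j \<and> i \<noteq> u \<and> j \<noteq> u \<and> num_shortest E i j > 0}"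
  let ?f = "\<lambda>(i, j). real (num_shortest_through E u i j) / real (num_shortest E i j)"
  \<comment> \<open>The square of \<open>K\<close> without its diagonal: exactly the ordered pairs
    with a shortest path through \<open>u\<close>, one of two.\<close>
  let ?B = "K \<times> K - (\<lambda>i. (i, i)) ` K"
  have pos: "num_shortest E i j > 0"
    if "i < n" "j < n" "i \<noteq> j" "i \<noteq> u" "j \<noteq> u" for i j
    using that by (simp add: num_shortest_def shortest_paths_avoiding_u card_gt_0_iff)
  have val: "?f (i, j) = (if i \<in> K \<and> j \<in> K then 1 / 2 else 0)"
    if "i < n" "j < n" "i \<noteq> j" "i \<noteq> u" "j \<noteq> u" for i j
  proof -
    have through: "{p \<in> shortest_paths E i j. u \<in> set p} =
        (if i \<in> K \<and> j \<in> K then {[i, u, j]} else {})"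
      using that u K by (auto simp: shortest_paths_avoiding_u)
    have "num_shortest E i j = (if i \<in> K \<and> j \<in> K then 2 else 1)"
      using that u K by (auto simp: num_shortest_def shortest_paths_avoiding_u)
    then show ?thesis
      by (simp add: num_shortest_through_def through)
  qed
  have fin: "finite ?A"
    by (rule finite_subset[of _ "{..<n} \<times> {..<n}"]) auto
  have "sum ?f ?A = (\<Sum>_\<in>?B. 1 / 2)"
  proof (rule sum.mono_neutral_cong_right[OF fin])
    show "?B \<subseteq> ?A"
      using K by (auto intro!: pos)
    show "\<forall>x\<in>?A - ?B. ?f x = 0"
    proof
      fix x assume x: "x \<in> ?A - ?B"
      obtain i j where ij: "x = (i, j)" by (cases x)
      with x have "i < n" "j < n" "i \<noteq> j" "i \<noteq> u" "j \<noteq> u" "\<not> (i \<in> K \<and> j \<in> K)"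
        by auto
      then show "?f x = 0"
        unfolding ij by (subst val) auto
    qed
    fix x assume x: "x \<in> ?B"
    obtain i j where ij: "x = (i, j)" by (cases x)
    with x K have "i < n" "j < n" "i \<noteq> j" "i \<noteq> u" "j \<noteq> u" "i \<in> K" "j \<in> K"
      by auto
    then show "?f x = 1 / 2"
      unfolding ij by (subst val) auto
  qed
  also have "\<dots> = real (card ?B) / 2"
    by simp
  also have "real (card ?B) = real (card K) * (real (card K) - 1)"
  proof -
    have "card ((\<lambda>i. (i, i)) ` K) = card K"
      by (rule card_image) (simp add: inj_on_def)
    then have "card ?B = card K * card K - card K"
      by (subst card_Diff_subset) (auto simp: finite_K card_cartesian_product)
    then show ?thesis
      by (simp add: of_nat_diff algebra_simps)
  qed
  finally show ?thesis
    unfolding betweenness_def by simp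
qed

text \<open>Only the created graph is fixed, not who pays for the edges of the star, so
  \<open>card (s u)\<close> remains a separate term.\<close>

lemma cost_u:
  assumes "created_graph n s = E"
  shows "cost n b c s u =
    ereal (real (card (s u)) + b * ((real n - 1) * (real n - 2) - real (card K) * (real (card K) - 1) / 2)
      + c * (real n - 2 - real (card K)))"
  unfolding cost_def assms betweenness_u closeness_u by simp

end

section \<open>When the star is an equilibrium\<close>

lemma created_graph_add:
  assumes "u < n" "t \<subseteq> {..<n}"
  shows "created_graph n (s(u := s u \<union> t)) = created_graph n s \<union> {{u, v} |v. v \<in> t}"
proof (rule set_eqI)
  fix e
  show "e \<in> created_graph n (s(u := s u \<union> t)) \<longleftrightarrow> e \<in> created_graph n s \<union> {{u, v} |v. v \<in> t}"
    using assms unfolding created_graph_def by (auto split: if_splits)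
qed

theorem theorem7:
  fixes n r :: nat and b c :: real
  assumes "n \<ge> 4" and "r < n" and "b \<ge> 0" and "c > 0"
  shows "nash_equilibrium_graph n b c (star_graph n r) \<longleftrightarrow> 0 \<le> 1 - (real n - 3) / 2 * b - c"
proof
  assume "nash_equilibrium_graph n b c (star_graph n r)"
  then obtain s where s: "nash_equilibrium n b c s" and G: "created_graph n s = star_graph n r"
    by (auto simp: nash_equilibrium_graph_def)
  obtain u where u: "u < n" "u \<noteq> r"
  proof (cases "r = 0")
    case True then show thesis using assms(1) that[of 1] by simp
  next
    case False then show thesis using assms(1) that[of 0] by simp
  qed
  \<comment> \<open>Linking \<open>u\<close> to all other leaves is the extreme deviation, whose
    failure to pay off gives the required inequality.\<close>
  define L where "L = {..<n} - {r, u}"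
  have card_L: "card L = n - 2"
    unfolding L_def using assms(2) u by (subst card_Diff_subset) auto
  interpret star: leaf_deviation n r u "{}"
    by unfold_locales (use assms(2) u in auto)
  interpret dev: leaf_deviation n r u L
    by unfold_locales (use assms(2) u in \<open>auto simp: L_def\<close>)
  have su: "s u \<in> strategies n u"
    using s u(1) by (auto simp: nash_equilibrium_def strategy_combination_def)
  \<comment> \<open>The equilibrium \<open>s\<close> is arbitrary, so \<open>u\<close> may itself
    own the channel to \<open>r\<close>, but no other. Hence \<open>s u\<close> and \<open>L\<close>
    are disjoint, and the deviation costs exactly \<open>card L\<close> additional channels.\<close>
  have su_r: "s u \<subseteq> {r}"
  proof
    fix v assume v: "v \<in> s u"
    then have "{u, v} \<in> star_graph n r"
      using su u(1) by (auto simp: G[symmetric] created_graph_def strategies_def)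
    with u show "v \<in> {r}"
      by (auto simp: star_graph_def doubleton_eq_iff)
  qed
  let ?t = "s u \<union> L"
  have t: "?t \<in> strategies n u"
    using su by (auto simp: strategies_def L_def)
  have Gt: "created_graph n (s(u := ?t)) = augmented_star n r u L"
    using u(1) by (subst created_graph_add) (auto simp: L_def G augmented_star_def)
  have "card ?t = card (s u) + card L"
    using su_r by (intro card_Un_disjoint) (auto simp: L_def intro: finite_subset)
  moreover have "cost n b c s u \<le> cost n b c (s(u := ?t)) u"
    using s t u(1) by (auto simp: nash_equilibrium_def not_less)
  moreover define k where "k = real n - 2"
  then have "real (card L) = k" "k > 0"
    using assms(1) by (auto simp: card_L of_nat_diff)
  \<comment> \<open>The right-hand side is the change in cost of \<open>u\<close>; dividing by
    \<open>k > 0\<close> and substituting \<open>k = n - 2\<close> gives the claim.\<close>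
  ultimately have "0 \<le> k * (1 - (k - 1) / 2 * b - c)"
    using star.cost_u[of s b c] dev.cost_u[OF Gt, of b c] G
    by (simp add: algebra_simps)
  with \<open>k > 0\<close> show "0 \<le> 1 - (real n - 3) / 2 * b - c"
    by (simp add: zero_le_mult_iff k_def)
next
  assume cond: "0 \<le> 1 - (real n - 3) / 2 * b - c"
  define s where "s = (\<lambda>v. if v = r then {..<n} - {r} else {})"
  have G: "created_graph n s = star_graph n r"
    using assms(2) by (auto simp: s_def created_graph_def star_graph_def)
  have comb: "strategy_combination n s"
    by (auto simp: s_def strategy_combination_def strategies_def)
  have centre: "\<not> cost n b c (s(r := t)) r < cost n b c s r" if t: "t \<in> strategies n r" for t
  proof (cases "t = s r")
    case True
    then show ?thesis by simp
  next
    case False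
    \<comment> \<open>\<open>s r\<close> already contains every possible partner, so any other
      strategy misses some leaf \<open>v\<close>. Leaves open no channels, so \<open>v\<close>
      becomes isolated.\<close>
    then obtain v where v: "v < n" "v \<noteq> r" "v \<notin> t"
      using t by (auto simp: s_def strategies_def)
    let ?G = "created_graph n (s(r := t))"
    have "{x, v} \<notin> ?G" for x
      using v by (auto simp: created_graph_def s_def doubleton_eq_iff split: if_splits)
    then have "graph_dist ?G r v = \<infinity>"
      using v(2) by (intro graph_dist_isolated) auto
    then have "ereal_of_enat (graph_dist ?G r v) - 1 = \<infinity>"
      by simp
    moreover have "v \<in> {..<n} - {r}"
      using v by simp
    ultimately have "closeness n ?G r = \<infinity>"
      unfolding closeness_def by (subst sum_Pinfty) blast
    then show ?thesis
      using assms(4) by (simp add: cost_def)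
  qed
  have leaf: "\<not> cost n b c (s(u := t)) u < cost n b c s u"
    if u: "u < n" "u \<noteq> r" and t: "t \<in> strategies n u" for u t
  proof -
    \<comment> \<open>A channel to \<open>r\<close> would duplicate an edge of the star: it is paid
      for but leaves the graph unchanged. Hence only \<open>K\<close> matters for the graph, while
      the price \<open>card t\<close> is at least \<open>card K\<close>.\<close>
    define K where "K = t - {r}"
    have K: "K \<subseteq> {..<n} - {r, u}"
      using t by (auto simp: K_def strategies_def)
    interpret star: leaf_deviation n r u "{}"
      by unfold_locales (use assms(2) u in auto)
    interpret dev: leaf_deviation n r u K
      by unfold_locales (use assms(2) u K in auto)
    have su: "s u = {}"
      using u by (simp add: s_def)
    have "{u, r} \<in> star_graph n r"
      using u by (auto simp: star_graph_def)
    \<comment> \<open>Since \<open>s u\<close> is empty, an arbitrary \<open>t\<close> is an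
      addition to the old strategy.\<close>
    then have Gt: "created_graph n (s(u := t)) = augmented_star n r u K"
      using created_graph_add[of u n t s] u t
      by (auto simp: su G augmented_star_def strategies_def K_def)
    define k where "k = real (card K)"
    have "finite t"
      using t by (auto simp: strategies_def intro: finite_subset)
    then have k_le: "k \<le> real (card t)"
      by (auto simp: k_def K_def intro: card_mono)
    have "k \<le> real n - 2"
      using dev.card_K_le assms(1) by (simp add: k_def)
    \<comment> \<open>As \<open>b \<ge> 0\<close>, the factor \<open>1 - (k - 1) / 2 * b - c\<close>
      is smallest at \<open>k = n - 2\<close>, where \<open>cond\<close> says that it is
      nonnegative.\<close>
    then have "(k - 1) / 2 * b \<le> (real n - 3) / 2 * b"
      using assms(3) by (intro mult_right_mono) auto
    with cond have "0 \<le> k * (1 - (k - 1) / 2 * b - c)"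
      by (intro mult_nonneg_nonneg) (auto simp: k_def)
    with k_le show ?thesis
      using star.cost_u[of s b c] dev.cost_u[OF Gt, of b c] G
      by (simp add: su not_less k_def[symmetric] algebra_simps)
  qed
  have "nash_equilibrium n b c s"
    using comb centre leaf unfolding nash_equilibrium_def by metis
  with G show "nash_equilibrium_graph n b c (star_graph n r)"
    unfolding nash_equilibrium_graph_def by metis
qed

end
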